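(* Consider the fully discrete, linearly implicit Crank–Nicolson scheme with linear extrapolation: given the previous velocities $w^h_n,w^h_{n-1}\in X^h$ and pressure $p^h_n\in Q^h$, find $(w^h_{n+1},p^h_{n+1})\in(X^h,Q^h)$ satisfying $$\Big(\frac{w^h_{n+1}-w^h_n}{k},v^h\Big)+\frac{C_s^4\delta^2}{\mu^2}\Big(\frac{\nabla w^h_{n+1}-\nabla w^h_n}{k},\nabla v^h\Big)+b^*(\tilde w^h_{n+\frac12},w^h_{n+\frac12},v^h)+\nu(\nabla w^h_{n+\frac12},\nabla v^h)$$ $$+(C_s\delta)^2\big(|\nabla\tilde w^h_{n+\frac12}|\nabla w^h_{n+\frac12},\nabla v^h\big)+\gamma(\nabla\cdot w^h_{n+\frac12},\nabla\cdot v^h)-(p^h_{n+\frac12},\nabla\cdot v^h)=(f_{n+\frac12},v^h)\quad\forall v^h\in X^h,$$ $$(\nabla\cdot w^h_{n+\frac12},q^h)=0\quad\forall q^h\in Q^h .$$ This method is unconditionally energy stable: for any $N\ge1$ (and any time step $k>0$), $$\Big(\frac12\|w^h_N\|^2+\frac12\frac{C_s^4\delta^2}{\mu^2}\|\nabla w^h_N\|^2\Big)+k\sum_{n=0}^{N-1}\Big\{\int_\Omega\big[\nu+(C_s\delta)^2|\nabla\tilde w^h_{n+\frac12}|\big]|\nabla w^h_{n+\frac12}|^2\,dx+\gamma\|\nabla\cdot w^h_{n+\frac12}\|^2\Big\}$$ $$=\Big(\frac12\|w^h_0\|^2+\frac12\frac{C_s^4\delta^2}{\mu^2}\|\nabla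 w^h_0\|^2\Big)+k\sum_{n=0}^{N-1}\big(f_{n+\frac12},w^h_{n+\frac12}\big).$$
   Context: $\Omega\subset\mathbb{R}^d$ ($d=2$ or $3$) is a regular bounded flow domain. $\nu>0$, $C_s,\delta,\mu>0$ and $\gamma$ (grad-div stabilization parameter) are constants. $\|\cdot\|$ and $(\cdot,\cdot)$ are the $L^2(\Omega)$ norm and inner product. $|\nabla w|$ is the Euclidean (Frobenius) norm of the velocity gradient. $X=\{v\in L^3(\Omega):\nabla v\in L^3(\Omega),\ v=0\text{ on }\partial\Omega\}$ (vector fields), $Q=\{q\in L^2(\Omega):\int_\Omega q\,dx=0\}$; $X^h\subset X$, $Q^h\subset Q$ are finite element spaces satisfying the discrete inf-sup condition $\inf_{\lambda^h\in Q^h}\sup_{v^h\in X^h}\frac{(\lambda^h,\nabla\cdot v^h)}{\|\lambda^h\|\|\nabla v^h\|}\ge\beta^h>0$ with $\beta^h$ bounded away from zero uniformly in $h$. Trilinear form: $b^*(u,v,w)=\frac12(u\cdot\nabla v,w)-\frac12(u\cdot\nabla w,v)$. $k>0$ is the time step, $t_n=nk$, $f_n(x)=f(x,t_n)$ for the prescribed body force $f$, and $w^h_n$, $p^h_n$ approximate the velocity and pressure of the Corrected Smagorinsky Model at time $t_n$. Half-step notation: $w^h_{n+\frac12}=\frac{w^h_n+w^h_{n+1}}{2}$ (likewise for $p^h$ and $f$), and the extrapolation is $\tilde w^h_{n+\frac12}=\frac{3w^h_n-w^h_{n-1}}{2}$. For $n=0$ a starting value $w^h_{-1}\in X^h$ is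 assumed given. *)

theory Defs
  imports "HOL-Analysis.Analysis"
begin

text \<open>Fields are functions on the whole of \<open>real ^ 'd\<close> of which only the values on \<open>\<Omega>\<close> matter,
  up to null sets.\<close>

text \<open>\<open>regular\<close> is read as: the boundary is locally the graph of a Lipschitz function, with
  \<open>\<Omega>\<close> on one side. The graph function is applied to the projection of \<open>x\<close> onto the hyperplane
  orthogonal to the direction \<open>e\<close>.\<close>

definition regular_bounded_domain :: "(real ^ 'd) set \<Rightarrow> bool" where
  "regular_bounded_domain \<Omega> \<longleftrightarrow>
     open \<Omega> \<and> connected \<Omega> \<and> bounded \<Omega> \<and> \<Omega> \<noteq> {} \<and>
     (\<forall>y \<in> frontier \<Omega>. \<exists>e r L. \<exists>g :: real ^ 'd \<Rightarrow> real.
        norm e = 1 \<and> r > 0 \<and> L-lipschitz_on UNIV g \<and>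
        \<Omega> \<inter> ball y r = {x \<in> ball y r. g (x - (x \<bullet> e) *\<^sub>R e) < x \<bullet> e})"

definition Lp_space :: "real \<Rightarrow> (real ^ 'd) set \<Rightarrow> (real ^ 'd \<Rightarrow> 'b::euclidean_space) set" where
  "Lp_space p \<Omega> = {u. u \<in> borel_measurable (lebesgue_on \<Omega>) \<and>
                      integrable (lebesgue_on \<Omega>) (\<lambda>x. norm (u x) powr p)}"

text \<open>On \<open>real ^ 'd ^ 'd\<close> the library's inner product and norm are those of Frobenius.\<close>

definition L2_inner ::
    "(real ^ 'd) set \<Rightarrow> (real ^ 'd \<Rightarrow> 'b::euclidean_space) \<Rightarrow> (real ^ 'd \<Rightarrow> 'b) \<Rightarrow> real" where
  "L2_inner \<Omega> u v = (LINT x|lebesgue_on \<Omega>. u x \<bullet> v x)"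

definition L2_norm :: "(real ^ 'd) set \<Rightarrow> (real ^ 'd \<Rightarrow> 'b::euclidean_space) \<Rightarrow> real" where
  "L2_norm \<Omega> u = sqrt (L2_inner \<Omega> u u)"

definition partial_deriv :: "'d \<Rightarrow> (real ^ 'd \<Rightarrow> 'b::euclidean_space) \<Rightarrow> real ^ 'd \<Rightarrow> 'b" where
  "partial_deriv j \<phi> x = frechet_derivative \<phi> (at x) (axis j 1)"

definition C1_compact_support ::
    "(real ^ 'd) set \<Rightarrow> (real ^ 'd \<Rightarrow> 'b::euclidean_space) set" where
  "C1_compact_support \<Omega> =
     {\<phi>. (\<forall>x. \<phi> differentiable (at x)) \<and> (\<forall>j. continuous_on UNIV (partial_deriv j \<phi>)) \<and>
         compact (closure {x. \<phi> x \<noteq> 0}) \<and> closure {x. \<phi> x \<noteq> 0} \<subseteq> \<Omega>}"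

definition locally_integrable_on ::
    "(real ^ 'd) set \<Rightarrow> (real ^ 'd \<Rightarrow> 'b::euclidean_space) \<Rightarrow> bool" where
  "locally_integrable_on \<Omega> u \<longleftrightarrow> (\<forall>K. compact K \<and> K \<subseteq> \<Omega> \<longrightarrow> integrable (lebesgue_on K) u)"

text \<open>Weak gradients, with the convention \<open>G $ i $ j = \<partial>\<^sub>j v\<^sub>i\<close>.\<close>

definition has_weak_gradient ::
    "(real ^ 'd) set \<Rightarrow> (real ^ 'd \<Rightarrow> real ^ 'd) \<Rightarrow> (real ^ 'd \<Rightarrow> real ^ 'd ^ 'd) \<Rightarrow> bool" where
  "has_weak_gradient \<Omega> v G \<longleftrightarrow>
     locally_integrable_on \<Omega> v \<and> locally_integrable_on \<Omega> G \<and>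
     (\<forall>\<phi> \<in> C1_compact_support \<Omega>. \<forall>i j.
        (LINT x|lebesgue_on \<Omega>. v x $ i * partial_deriv j \<phi> x) =
        - (LINT x|lebesgue_on \<Omega>. G x $ i $ j * \<phi> x))"

definition weak_grad ::
    "(real ^ 'd) set \<Rightarrow> (real ^ 'd \<Rightarrow> real ^ 'd) \<Rightarrow> real ^ 'd \<Rightarrow> real ^ 'd ^ 'd" where
  "weak_grad \<Omega> v = (SOME G. has_weak_gradient \<Omega> v G)"

definition weak_div :: "(real ^ 'd) set \<Rightarrow> (real ^ 'd \<Rightarrow> real ^ 'd) \<Rightarrow> real ^ 'd \<Rightarrow> real" where
  "weak_div \<Omega> v x = trace (weak_grad \<Omega> v x)"

text \<open>The boundary condition \<open>v = 0\<close> is the one of \<open>W\<^sub>0\<^sup>1\<^sup>,\<^sup>3\<close>: \<open>v\<close> is a \<open>W\<^sup>1\<^sup>,\<^sup>3\<close>-limit of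
  compactly supported \<open>C\<^sup>1\<close> vector fields.\<close>

definition velocity_space :: "(real ^ 'd) set \<Rightarrow> (real ^ 'd \<Rightarrow> real ^ 'd) set" where
  "velocity_space \<Omega> =
     {v. v \<in> Lp_space 3 \<Omega> \<and> (\<exists>G. has_weak_gradient \<Omega> v G) \<and> weak_grad \<Omega> v \<in> Lp_space 3 \<Omega> \<and>
         (\<exists>\<phi>. (\<forall>m::nat. \<phi> m \<in> C1_compact_support \<Omega>) \<and>
              (\<lambda>m. LINT x|lebesgue_on \<Omega>. norm (\<phi> m x - v x) powr 3) \<longlonglongrightarrow> 0 \<and>
              (\<lambda>m. LINT x|lebesgue_on \<Omega>.
                     norm (matrix (frechet_derivative (\<phi> m) (at x)) - weak_grad \<Omega> v x) powr 3)
                \<longlonglongrightarrow> 0)}"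

definition pressure_space :: "(real ^ 'd) set \<Rightarrow> (real ^ 'd \<Rightarrow> real) set" where
  "pressure_space \<Omega> = {q \<in> Lp_space 2 \<Omega>. (LINT x|lebesgue_on \<Omega>. q x) = 0}"

definition finite_dim_subspace ::
    "(real ^ 'd) set \<Rightarrow> (real ^ 'd \<Rightarrow> 'b::euclidean_space) set \<Rightarrow> bool" where
  "finite_dim_subspace \<Omega> V \<longleftrightarrow>
     (\<lambda>x. 0) \<in> V \<and> (\<forall>u \<in> V. \<forall>v \<in> V. (\<lambda>x. u x + v x) \<in> V) \<and>
     (\<forall>c. \<forall>u \<in> V. (\<lambda>x. c *\<^sub>R u x) \<in> V) \<and>
     (\<exists>B. finite B \<and> B \<subseteq> V \<and>
        (\<forall>v \<in> V. \<exists>c. AE x in lebesgue_on \<Omega>. v x = (\<Sum>b\<in>B. c b *\<^sub>R b x)))"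

text \<open>The infimum and supremum run over the arguments for which the quotient makes sense; they are
  taken in the extended reals, so that no boundedness side condition is hidden.\<close>

definition inf_sup_condition ::
    "(real ^ 'd) set \<Rightarrow> (real ^ 'd \<Rightarrow> real ^ 'd) set \<Rightarrow> (real ^ 'd \<Rightarrow> real) set \<Rightarrow> real \<Rightarrow> bool" where
  "inf_sup_condition \<Omega> V P \<beta> \<longleftrightarrow>
     ereal \<beta> \<le> (INF q \<in> {q \<in> P. L2_norm \<Omega> q \<noteq> 0}.
                  SUP v \<in> {v \<in> V. L2_norm \<Omega> (weak_grad \<Omega> v) \<noteq> 0}.
                    ereal (L2_inner \<Omega> q (weak_div \<Omega> v) /
                           (L2_norm \<Omega> q * L2_norm \<Omega> (weak_grad \<Omega> v))))"

text \<open>\<open>((u \<cdot> \<nabla>) v)\<^sub>i = \<Sum>\<^sub>j u\<^sub>j \<partial>\<^sub>j v\<^sub>i\<close>\<close>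

definition convect ::
    "(real ^ 'd) set \<Rightarrow> (real ^ 'd \<Rightarrow> real ^ 'd) \<Rightarrow> (real ^ 'd \<Rightarrow> real ^ 'd) \<Rightarrow> real ^ 'd \<Rightarrow> real ^ 'd"
  where "convect \<Omega> u v x = weak_grad \<Omega> v x *v u x"

definition b_star ::
    "(real ^ 'd) set \<Rightarrow> (real ^ 'd \<Rightarrow> real ^ 'd) \<Rightarrow> (real ^ 'd \<Rightarrow> real ^ 'd) \<Rightarrow>
     (real ^ 'd \<Rightarrow> real ^ 'd) \<Rightarrow> real" where
  "b_star \<Omega> u v w = 1/2 * L2_inner \<Omega> (convect \<Omega> u v) w - 1/2 * L2_inner \<Omega> (convect \<Omega> u w) v"

text \<open>Half-step average and extrapolation. Time levels are integers, since the velocity sequence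
  starts at level \<open>-1\<close>.\<close>

definition half_step :: "(int \<Rightarrow> real ^ 'd \<Rightarrow> 'b::euclidean_space) \<Rightarrow> int \<Rightarrow> real ^ 'd \<Rightarrow> 'b" where
  "half_step w n x = (1/2) *\<^sub>R (w n x + w (n + 1) x)"

definition extrapolated :: "(int \<Rightarrow> real ^ 'd \<Rightarrow> 'b::euclidean_space) \<Rightarrow> int \<Rightarrow> real ^ 'd \<Rightarrow> 'b" where
  "extrapolated w n x = (1/2) *\<^sub>R (3 *\<^sub>R w n x - w (n - 1) x)"

definition at_time_level ::
    "real \<Rightarrow> (real ^ 'd \<Rightarrow> real \<Rightarrow> real ^ 'd) \<Rightarrow> int \<Rightarrow> real ^ 'd \<Rightarrow> real ^ 'd" where
  "at_time_level k f n x = f x (of_int n * k)"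

text \<open>The two equations determining level \<open>n + 1\<close> from levels \<open>n\<close> and \<open>n - 1\<close>, with discrete
  velocity space \<open>V\<close> and pressure space \<open>P\<close>.\<close>

definition crank_nicolson_step ::
    "(real ^ 'd) set \<Rightarrow> (real ^ 'd \<Rightarrow> real ^ 'd) set \<Rightarrow> (real ^ 'd \<Rightarrow> real) set \<Rightarrow>
     real \<Rightarrow> real \<Rightarrow> real \<Rightarrow> real \<Rightarrow> real \<Rightarrow> real \<Rightarrow> (real ^ 'd \<Rightarrow> real \<Rightarrow> real ^ 'd) \<Rightarrow>
     (int \<Rightarrow> real ^ 'd \<Rightarrow> real ^ 'd) \<Rightarrow> (int \<Rightarrow> real ^ 'd \<Rightarrow> real) \<Rightarrow> int \<Rightarrow> bool" where
  "crank_nicolson_step \<Omega> V P \<nu> C\<^sub>s \<delta> \<mu> \<gamma> k f w p n \<longleftrightarrow>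
     (\<forall>v \<in> V.
        L2_inner \<Omega> (\<lambda>x. (1/k) *\<^sub>R (w (n + 1) x - w n x)) v
        + C\<^sub>s^4 * \<delta>^2 / \<mu>^2 *
            L2_inner \<Omega> (\<lambda>x. (1/k) *\<^sub>R (weak_grad \<Omega> (w (n + 1)) x - weak_grad \<Omega> (w n) x))
              (weak_grad \<Omega> v)
        + b_star \<Omega> (extrapolated w n) (half_step w n) v
        + \<nu> * L2_inner \<Omega> (weak_grad \<Omega> (half_step w n)) (weak_grad \<Omega> v)
        + (C\<^sub>s * \<delta>)^2 *
            L2_inner \<Omega> (\<lambda>x. norm (weak_grad \<Omega> (extrapolated w n) x) *\<^sub>R
                             weak_grad \<Omega> (half_step w n) x) (weak_grad \<Omega> v)
        + \<gamma> * L2_inner \<Omega> (weak_div \<Omega> (half_step w n)) (weak_div \<Omega> v)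
        - L2_inner \<Omega> (half_step p n) (weak_div \<Omega> v)
        = L2_inner \<Omega> (half_step (at_time_level k f) n) v) \<and>
     (\<forall>q \<in> P. L2_inner \<Omega> (weak_div \<Omega> (half_step w n)) q = 0)"

end

theory Submission
  imports Defs
begin

text \<open>Testing the momentum equation of each time step with the half-step velocity gives an exact
  energy balance for that step (\<open>crank_nicolson_step_energy\<close>), and these balances telescope. The
  convective term vanishes since its form is skew-symmetric (\<open>b_star_same\<close>), whatever the
  extrapolated velocity. The pressure term vanishes since the half-step pressure is an admissible test
  function in the divergence constraint. The difference quotients, tested with the mean of the two
  time levels, are differences of squares (\<open>L2_inner_difference_quotient_mean\<close>). No inequality is
  used, which is why the balance is an equality for every step size.

  Two analytic points stand behind this algebra. The integrals must be finite before they can be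
  split: on a bounded domain the \<open>L\<^sup>3\<close> bounds on velocities and gradients suffice, including for the
  cubic Smagorinsky term. And the gradient of the half-step velocity must be the mean of the gradients
  at the two levels. A weak gradient is defined only up to null sets, and \<open>weak_grad\<close> picks one of
  them without regard to linear structure, so this is an almost everywhere statement
  (\<open>weak_grad_half_step\<close>). It rests on uniqueness of weak gradients, that is, on the fundamental lemma
  of the calculus of variations: a locally integrable function orthogonal to all compactly supported
  \<open>C\<^sup>1\<close> functions vanishes almost everywhere (\<open>du_Bois_Reymond\<close>). That lemma follows by approximating
  indicators of boxes by test functions, as integrals over boxes determine a function up to
  null sets.\<close>

section \<open>The fundamental lemma of the calculus of variations\<close>

text \<open>Boxes form a generator of the Borel sets that is stable under intersection, so vanishing
  integrals propagate from boxes to Borel sets by Dynkin's argument and from there to Lebesgue sets,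
  which differ from Borel sets by null sets. An integrable function is determined up to null
  sets by its integrals over measurable sets.\<close>

lemma AE_zero_if_integral_boxes_zero:
  fixes g :: "'a::euclidean_space \<Rightarrow> real"
  assumes g: "integrable lebesgue g"
    and boxes: "\<And>a b. (LINT x:box a b|lebesgue. g x) = 0"
  shows "AE x in lebesgue. g x = 0"
proof (rule density_unique_real[OF g integrable_zero])
  have set_int: "set_integrable lebesgue S g" if "S \<in> sets lebesgue" for S
    unfolding set_integrable_def using that g by (rule integrable_mult_indicator)
  have borel_zero: "(LINT x:A|lebesgue. g x) = 0" if A: "A \<in> sets borel" for A
  proof -
    have "Int_stable (range (\<lambda>(a, b). box a b :: 'a set))"
      by (auto simp: Int_stable_def box_Int_box)
    moreover have "range (\<lambda>(a, b). box a b :: 'a set) \<subseteq> Pow UNIV"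
      by auto
    moreover have "A \<in> sigma_sets UNIV (range (\<lambda>(a, b). box a b))"
      using A unfolding borel_eq_box by simp
    ultimately show ?thesis
    proof (induction rule: sigma_sets_induct_disjoint)
      case (basic A)
      then show ?case using boxes by auto
    next
      case empty
      then show ?case by (simp add: set_lebesgue_integral_def)
    next
      case (compl A)
      then have "A \<in> sets borel"
        by (simp add: borel_eq_box)
      then have A: "A \<in> sets lebesgue"
        by simp
      \<comment> \<open>Complements need the integral over the whole space, a limit of integrals over boxes.\<close>
      let ?B = "\<lambda>n::nat. box (- (real n *\<^sub>R One)) (real n *\<^sub>R One) :: 'a set"
      have "incseq ?B"
        unfolding incseq_def
        by (intro allI impI subset_box_imp) (auto simp: inner_simps)
      then have "(\<lambda>n. LINT x:?B n|lebesgue. g x) \<longlonglongrightarrow> (LINT x:(\<Union>n. ?B n)|lebesgue. g x)"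
        by (intro set_integral_cont_up set_int) auto
      then have UNIV: "(LINT x:UNIV|lebesgue. g x) = 0"
        by (simp add: UN_box_eq_UNIV boxes LIMSEQ_const_iff)
      have "(LINT x:A \<union> (UNIV - A)|lebesgue. g x)
          = (LINT x:A|lebesgue. g x) + (LINT x:UNIV - A|lebesgue. g x)"
        using A by (intro set_integral_Un set_int) auto
      then show ?case
        using compl UNIV by simp
    next
      case (union F)
      then have "\<And>i. F i \<in> sets borel"
        by (simp add: borel_eq_box subset_eq)
      then have F: "\<And>i. F i \<in> sets lebesgue"
        by simp
      have "(LINT x:(\<Union>i. F i)|lebesgue. g x) = (\<Sum>i. LINT x:F i|lebesgue. g x)"
        using F union(1)
        by (intro lebesgue_integral_countable_add set_int) (auto simp: disjoint_family_on_def)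
      then show ?case
        using union by simp
    qed
  qed
  fix A :: "'a set" assume "A \<in> sets lebesgue"
  then obtain S N N' where A: "A = S \<union> N" "N \<subseteq> N'" "N' \<in> null_sets lborel" "S \<in> sets lborel"
    by (rule sets_completionE)
  then have "(A - S) \<union> (S - A) \<subseteq> N'" "N' \<in> null_sets lebesgue"
    by (auto intro: null_sets_completionI)
  then have "(A - S) \<union> (S - A) \<in> null_sets lebesgue"
    by (rule null_sets_completion_subset)
  then have "(LINT x:A|lebesgue. g x) = (LINT x:S|lebesgue. g x)"
    using A g \<open>A \<in> sets lebesgue\<close> by (intro set_integral_null_delta) auto
  also have "\<dots> = 0"
    using A by (intro borel_zero) simp
  finally show "(LINT x:A|lebesgue. g x) = (LINT x:A|lebesgue. 0)"
    by (simp add: set_lebesgue_integral_def)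
qed

text \<open>The scalar test functions of the weak gradient, without the condition on the support; this
  part is stable under products and composition.\<close>

definition C1_function :: "(real ^ 'd \<Rightarrow> real) \<Rightarrow> bool" where
  "C1_function \<phi> \<longleftrightarrow> (\<forall>x. \<phi> differentiable (at x)) \<and> (\<forall>j. continuous_on UNIV (partial_deriv j \<phi>))"

lemma C1_functionI:
  assumes "\<And>x. (\<phi> has_derivative \<phi>' x) (at x)"
    and "\<And>j. continuous_on UNIV (\<lambda>x. \<phi>' x (axis j 1))"
  shows "C1_function \<phi>"
proof -
  have "partial_deriv j \<phi> = (\<lambda>x. \<phi>' x (axis j 1))" for j
    unfolding partial_deriv_def using frechet_derivative_at[OF assms(1)] by metis
  then show ?thesis
    using assms unfolding C1_function_def differentiable_def by metis
qed

lemma C1_functionD: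
  assumes "C1_function \<phi>"
  shows "(\<phi> has_derivative frechet_derivative \<phi> (at x)) (at x)"
    and "continuous_on UNIV (\<lambda>x. frechet_derivative \<phi> (at x) (axis j 1))"
    and "continuous_on UNIV \<phi>"
  using assms unfolding C1_function_def
  by (auto simp: frechet_derivative_works partial_deriv_def[abs_def]
      intro: differentiable_imp_continuous_on simp: differentiable_on_def)

lemma C1_function_const: "C1_function (\<lambda>x. c)"
  by (rule C1_functionI[where \<phi>' = "\<lambda>x h. 0"]) auto

lemma C1_function_component: "C1_function (\<lambda>x. x $ i)"
  by (rule C1_functionI[where \<phi>' = "\<lambda>x h. h $ i"])
    (auto intro: bounded_linear.has_derivative[OF bounded_linear_vec_nth has_derivative_ident])

lemma C1_function_diff:
  assumes "C1_function \<phi>" "C1_function \<psi>"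
  shows "C1_function (\<lambda>x. \<phi> x - \<psi> x)"
  by (rule C1_functionI[OF has_derivative_diff[OF C1_functionD(1) C1_functionD(1)]])
    (auto intro!: continuous_intros C1_functionD(1,2) C1_functionD(3)[of \<phi>] C1_functionD(3)[of \<psi>] assms)

lemma C1_function_mult:
  assumes "C1_function \<phi>" "C1_function \<psi>"
  shows "C1_function (\<lambda>x. \<phi> x * \<psi> x)"
  by (rule C1_functionI[OF has_derivative_mult[OF C1_functionD(1) C1_functionD(1)]])
    (auto intro!: continuous_intros C1_functionD(1,2) C1_functionD(3)[of \<phi>] C1_functionD(3)[of \<psi>] assms)

lemma C1_function_prod:
  assumes "finite I" "\<And>i. i \<in> I \<Longrightarrow> C1_function (\<phi> i)"
  shows "C1_function (\<lambda>x. \<Prod>i\<in>I. \<phi> i x)"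
  using assms by (induction I) (auto intro: C1_function_const C1_function_mult)

lemma C1_function_compose:
  assumes \<phi>: "C1_function \<phi>"
    and r: "\<And>t. (r has_real_derivative r' t) (at t)" "continuous_on UNIV r'"
  shows "C1_function (\<lambda>x. r (\<phi> x))"
proof (rule C1_functionI)
  show "((\<lambda>x. r (\<phi> x)) has_derivative (\<lambda>h. frechet_derivative \<phi> (at x) h * r' (\<phi> x))) (at x)" for x
    using r(1) by (rule DERIV_compose_FDERIV) (rule C1_functionD(1)[OF \<phi>])
  have "continuous_on UNIV (\<lambda>x. r' (\<phi> x))"
    using r(2) C1_functionD(3)[OF \<phi>] by (rule continuous_on_compose2) auto
  then show "continuous_on UNIV (\<lambda>x. frechet_derivative \<phi> (at x) (axis j 1) * r' (\<phi> x))" for j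
    by (intro continuous_intros C1_functionD(2) \<phi>)
qed

text \<open>Squaring removes the corner of the positive part, so this is a \<open>C\<^sup>1\<close> function that vanishes
  exactly for \<open>t \<le> 0\<close>: the one-dimensional building block for bumps on boxes.\<close>

lemma has_real_derivative_square_positive_part:
  "((\<lambda>t::real. (max 0 t)\<^sup>2) has_real_derivative 2 * max 0 t) (at t)"
proof -
  consider "t > 0" | "t < 0" | "t = 0" by linarith
  then show ?thesis
  proof cases
    case 1
    have "((\<lambda>t::real. t\<^sup>2) has_real_derivative 2 * t) (at t)"
      by (auto intro!: derivative_eq_intros)
    then show ?thesis
      using 1 by (rule_tac has_field_derivative_transform_within_open[where S = "{0<..}" and f = "\<lambda>t. t\<^sup>2"]) auto
  next
    case 2
    have "((\<lambda>t::real. 0) has_real_derivative 0) (at t)"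
      by simp
    then show ?thesis
      using 2 by (rule_tac has_field_derivative_transform_within_open[where S = "{..<0}" and f = "\<lambda>t. 0"]) auto
  next
    case 3
    have "((\<lambda>y::real. (max 0 y)\<^sup>2 / y) \<longlongrightarrow> 0) (at 0)"
    proof (rule Lim_null_comparison)
      show "\<forall>\<^sub>F y in at 0. norm ((max 0 y)\<^sup>2 / y) \<le> \<bar>y::real\<bar>"
        by (intro always_eventually allI) (auto simp: max_def power2_eq_square)
      show "((\<lambda>y::real. \<bar>y\<bar>) \<longlongrightarrow> 0) (at 0)"
        by (auto intro!: tendsto_eq_intros)
    qed
    then show ?thesis
      using 3 by (simp add: has_field_derivative_iff)
  qed
qed

text \<open>A product of one-dimensional bumps gives a \<open>C\<^sup>1\<close> function \<open>F \<ge> 0\<close> that is positive exactly on the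
  box. Then \<open>1 - exp (- m F)\<close> tends to 1 where \<open>F > 0\<close> and stays 0 elsewhere, with values in the unit
  interval throughout. The bound makes dominated convergence available.\<close>

lemma C1_approximation_of_indicator_box:
  fixes a b :: "real ^ 'd"
  shows "\<exists>\<phi> :: nat \<Rightarrow> real ^ 'd \<Rightarrow> real.
    (\<forall>m. C1_function (\<phi> m)) \<and> (\<forall>m x. \<bar>\<phi> m x\<bar> \<le> 1) \<and> (\<forall>m x. x \<notin> box a b \<longrightarrow> \<phi> m x = 0) \<and>
    (\<forall>x. (\<lambda>m. \<phi> m x) \<longlonglongrightarrow> indicator (box a b) x)"
proof -
  define F :: "real ^ 'd \<Rightarrow> real" where
    "F x = (\<Prod>i\<in>UNIV. (max 0 (x $ i - a $ i))\<^sup>2 * (max 0 (b $ i - x $ i))\<^sup>2)" for x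
  have F_nonneg: "F x \<ge> 0" for x
    unfolding F_def by (intro prod_nonneg) auto
  have F_outside: "F x = 0" if "x \<notin> box a b" for x
  proof -
    from that obtain i where "x $ i \<le> a $ i \<or> b $ i \<le> x $ i"
      by (auto simp: mem_box_cart not_less)
    then show ?thesis
      unfolding F_def by (intro prod_zero) (auto simp: max_def intro!: exI[of _ i])
  qed
  have F_inside: "F x > 0" if "x \<in> box a b" for x
    using that unfolding F_def
    by (intro prod_pos ballI mult_pos_pos zero_less_power) (auto simp: mem_box_cart less_max_iff_disj)
  have C1_square: "C1_function (\<lambda>x. (max 0 (\<psi> x))\<^sup>2)" if "C1_function \<psi>" for \<psi> :: "real ^ 'd \<Rightarrow> real"
    using that has_real_derivative_square_positive_part
    by (rule C1_function_compose) (auto intro!: continuous_intros)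
  have F_C1: "C1_function F"
    unfolding F_def[abs_def]
    by (intro C1_function_prod C1_function_mult C1_square C1_function_diff C1_function_component
        C1_function_const) auto
  let ?\<phi> = "\<lambda>m::nat. \<lambda>x. 1 - exp (- (real m * F x))"
  show ?thesis
  proof (intro exI[of _ ?\<phi>] conjI allI impI)
    show "C1_function (?\<phi> m)" for m
    proof (rule C1_function_compose[OF F_C1])
      show "((\<lambda>t. 1 - exp (- (real m * t))) has_real_derivative real m * exp (- (real m * t))) (at t)" for t
        by (auto intro!: derivative_eq_intros)
    qed (auto intro!: continuous_intros)
    show "\<bar>?\<phi> m x\<bar> \<le> 1" for m x
    proof -
      have "exp (- (real m * F x)) \<le> 1"
        using F_nonneg[of x] by simp
      then show ?thesis
        using exp_gt_zero[of "- (real m * F x)"] by linarith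
    qed
    show "?\<phi> m x = 0" if "x \<notin> box a b" for m x
      using F_outside[OF that] by simp
    show "(\<lambda>m. ?\<phi> m x) \<longlonglongrightarrow> indicator (box a b) x" for x
    proof (cases "x \<in> box a b")
      case True
      have "filterlim (\<lambda>m. real m * F x) at_top sequentially"
        using F_inside[OF True]
        by (intro filterlim_at_top_mult_tendsto_pos[OF tendsto_const _ filterlim_real_sequentially,
              of "F x", unfolded mult.commute[of "F x"]])
      then have "(\<lambda>m. exp (- (real m * F x))) \<longlonglongrightarrow> 0"
        by (intro filterlim_compose[OF exp_at_bot] filterlim_compose[OF filterlim_uminus_at_bot_at_top])
      then have "(\<lambda>m. ?\<phi> m x) \<longlonglongrightarrow> 1 - 0"
        by (intro tendsto_intros)
      then show ?thesis
        using True by simp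
    next
      case False
      then show ?thesis
        using F_outside[OF False] by simp
    qed
  qed
qed

lemma C1_compact_support_real_iff:
  "\<phi> \<in> C1_compact_support \<Omega> \<longleftrightarrow>
     C1_function \<phi> \<and> compact (closure {x. \<phi> x \<noteq> 0}) \<and> closure {x. \<phi> x \<noteq> 0} \<subseteq> \<Omega>"
  unfolding C1_compact_support_def C1_function_def by auto

lemma integrable_on_lebesgue_iff:
  fixes u :: "'a::euclidean_space \<Rightarrow> 'b::euclidean_space"
  assumes "S \<in> sets lebesgue"
  shows "integrable (lebesgue_on S) u \<longleftrightarrow> integrable lebesgue (\<lambda>x. indicator S x *\<^sub>R u x)"
  using assms by (intro integrable_restrict_space) simp

lemma locally_integrable_onD:
  fixes u :: "real ^ 'd \<Rightarrow> 'b::euclidean_space"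
  assumes "locally_integrable_on \<Omega> u" "compact K" "K \<subseteq> \<Omega>"
  shows "integrable lebesgue (\<lambda>x. indicator K x *\<^sub>R u x)"
proof -
  have "K \<in> sets borel"
    using assms(2) by (simp add: borel_compact)
  then have "K \<in> sets lebesgue"
    by simp
  from integrable_on_lebesgue_iff[OF this, of u] show ?thesis
    using assms by (simp add: locally_integrable_on_def)
qed

lemma continuous_imp_borel_measurable_lebesgue:
  fixes \<psi> :: "'a::euclidean_space \<Rightarrow> real"
  assumes "continuous_on UNIV \<psi>"
  shows "\<psi> \<in> borel_measurable lebesgue"
  using borel_measurable_continuous_onI[OF assms] by (intro measurable_completion) simp

text \<open>On \<open>K\<close> the continuous factor is bounded, off \<open>K\<close> the product vanishes. This makes every integral
  in the definition of the weak gradient a genuine one, so that these integrals may be added.\<close>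

lemma integrable_locally_integrable_mult:
  fixes u :: "real ^ 'd \<Rightarrow> real"
  assumes \<Omega>: "open \<Omega>" and K: "compact K" "K \<subseteq> \<Omega>"
    and u: "locally_integrable_on \<Omega> u"
    and \<psi>: "continuous_on UNIV \<psi>" "\<And>x. x \<notin> K \<Longrightarrow> \<psi> x = 0"
  shows "integrable (lebesgue_on \<Omega>) (\<lambda>x. u x * \<psi> x)"
proof -
  have \<Omega>_sets: "\<Omega> \<in> sets lebesgue"
    using \<Omega> by auto
  have "bounded (\<psi> ` K)"
    using K(1) \<psi>(1) by (meson compact_continuous_image compact_imp_bounded continuous_on_subset subset_UNIV)
  then obtain B where B: "\<And>x. x \<in> K \<Longrightarrow> \<bar>\<psi> x\<bar> \<le> B"
    by (auto simp: bounded_iff)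
  have uK: "integrable lebesgue (\<lambda>x. indicator K x *\<^sub>R u x)"
    using u K by (rule locally_integrable_onD)
  have \<psi>_meas: "\<psi> \<in> borel_measurable lebesgue"
    using \<psi>(1) by (rule continuous_imp_borel_measurable_lebesgue)
  have "integrable lebesgue (\<lambda>x. (indicator K x *\<^sub>R u x) * \<psi> x)"
  proof (rule Bochner_Integration.integrable_bound)
    show "integrable lebesgue (\<lambda>x. B *\<^sub>R (indicator K x *\<^sub>R u x))"
      using uK by (rule integrable_scaleR_right)
    show "(\<lambda>x. (indicator K x *\<^sub>R u x) * \<psi> x) \<in> borel_measurable lebesgue"
      using uK \<psi>_meas by (intro borel_measurable_times) auto
    show "AE x in lebesgue. norm ((indicator K x *\<^sub>R u x) * \<psi> x) \<le> norm (B *\<^sub>R (indicator K x *\<^sub>R u x))"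
    proof (intro always_eventually allI)
      fix x
      show "norm ((indicator K x *\<^sub>R u x) * \<psi> x) \<le> norm (B *\<^sub>R (indicator K x *\<^sub>R u x))"
      proof (cases "x \<in> K")
        case True
        have "\<bar>u x\<bar> * \<bar>\<psi> x\<bar> \<le> \<bar>u x\<bar> * \<bar>B\<bar>"
          using B[OF True] by (intro mult_left_mono) auto
        then show ?thesis
          using True by (simp add: abs_mult mult.commute)
      qed simp
    qed
  qed
  also have "(\<lambda>x. (indicator K x *\<^sub>R u x) * \<psi> x) = (\<lambda>x. indicator \<Omega> x *\<^sub>R (u x * \<psi> x))"
    using \<psi>(2) K(2) by (auto simp: fun_eq_iff indicator_def)
  finally show ?thesis
    using \<Omega>_sets by (simp add: integrable_on_lebesgue_iff)
qed

lemma integrable_mult_test_function: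
  fixes u :: "real ^ 'd \<Rightarrow> real"
  assumes \<Omega>: "open \<Omega>" and u: "locally_integrable_on \<Omega> u" and \<phi>: "\<phi> \<in> C1_compact_support \<Omega>"
  shows "integrable (lebesgue_on \<Omega>) (\<lambda>x. u x * \<phi> x)"
    and "integrable (lebesgue_on \<Omega>) (\<lambda>x. u x * partial_deriv j \<phi> x)"
proof -
  let ?K = "closure {x. \<phi> x \<noteq> 0}"
  have K: "compact ?K" "?K \<subseteq> \<Omega>" and C1: "C1_function \<phi>"
    using \<phi> by (auto simp: C1_compact_support_real_iff)
  show "integrable (lebesgue_on \<Omega>) (\<lambda>x. u x * \<phi> x)"
    using \<Omega> K u C1_functionD(3)[OF C1]
    by (rule integrable_locally_integrable_mult) (use closure_subset[of "{x. \<phi> x \<noteq> 0}"] in auto)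
  show "integrable (lebesgue_on \<Omega>) (\<lambda>x. u x * partial_deriv j \<phi> x)"
    using \<Omega> K u
  proof (rule integrable_locally_integrable_mult)
    show "continuous_on UNIV (partial_deriv j \<phi>)"
      using C1 by (simp add: C1_function_def)
    show "partial_deriv j \<phi> x = 0" if "x \<notin> ?K" for x
    proof -
      have "(\<phi> has_derivative (\<lambda>h. 0)) (at x)"
      proof (rule has_derivative_transform_within_open[of "\<lambda>x. 0"])
        show "open (- ?K)" "x \<in> - ?K"
          using that by auto
        show "0 = \<phi> y" if "y \<in> - ?K" for y
          using that closure_subset[of "{x. \<phi> x \<noteq> 0}"] by auto
      qed simp
      from frechet_derivative_at[OF this, symmetric] show ?thesis
        by (simp add: partial_deriv_def)
    qed
  qed
qed

text \<open>Passage to the limit in the test functions that approximate the indicator of the box. That the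
  closed box lies in \<open>\<Omega>\<close> gives these functions compact support in \<open>\<Omega>\<close>.\<close>

lemma integral_box_zero_if_orthogonal_to_test_functions:
  fixes g :: "real ^ 'd \<Rightarrow> real"
  assumes \<Omega>: "open \<Omega>" and g: "locally_integrable_on \<Omega> g"
    and orth: "\<And>\<phi>. \<phi> \<in> C1_compact_support \<Omega> \<Longrightarrow> (LINT x|lebesgue_on \<Omega>. g x * \<phi> x) = 0"
    and ab: "cbox a b \<subseteq> \<Omega>"
  shows "(LINT x:box a b|lebesgue. g x) = 0"
proof -
  have \<Omega>_sets: "\<Omega> \<in> sets lebesgue"
    using \<Omega> by auto
  obtain \<phi> :: "nat \<Rightarrow> real ^ 'd \<Rightarrow> real" where \<phi>:
    "\<And>m. C1_function (\<phi> m)"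
    "\<And>m x. \<bar>\<phi> m x\<bar> \<le> 1"
    "\<And>m x. x \<notin> box a b \<Longrightarrow> \<phi> m x = 0"
    "\<And>x. (\<lambda>m. \<phi> m x) \<longlonglongrightarrow> indicator (box a b) x"
    using C1_approximation_of_indicator_box[of a b] by blast
  have supp: "closure {x. \<phi> m x \<noteq> 0} \<subseteq> cbox a b" for m
    using \<phi>(3) box_subset_cbox[of a b] by (intro closure_minimal) auto
  have test: "\<phi> m \<in> C1_compact_support \<Omega>" for m
    unfolding C1_compact_support_real_iff
  proof (intro conjI)
    show "compact (closure {x. \<phi> m x \<noteq> 0})"
      using bounded_subset[OF bounded_cbox supp[of m]] by (simp add: compact_eq_bounded_closed)
    show "closure {x. \<phi> m x \<noteq> 0} \<subseteq> \<Omega>"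
      using supp[of m] ab by (rule order_trans)
  qed (rule \<phi>(1))
  let ?g = "\<lambda>x. indicator (cbox a b) x *\<^sub>R g x"
  have g_int: "integrable lebesgue ?g"
    using g compact_cbox ab by (rule locally_integrable_onD)
  have g_meas: "(\<lambda>x. ?g x * \<phi> m x) \<in> borel_measurable lebesgue" for m
    using g_int continuous_imp_borel_measurable_lebesgue[OF C1_functionD(3)[OF \<phi>(1)[of m]]]
    by (intro borel_measurable_times borel_measurable_integrable[OF g_int])
  have gbox_int: "integrable lebesgue (\<lambda>x. ?g x * indicator (box a b) x)"
    using integrable_mult_indicator[OF _ g_int, of "box a b"] by (simp add: mult.commute)
  have "(\<lambda>m. LINT x|lebesgue. ?g x * \<phi> m x) \<longlonglongrightarrow> (LINT x|lebesgue. ?g x * indicator (box a b) x)"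
  proof (rule integral_dominated_convergence[where w = "\<lambda>x. norm (?g x)"])
    show "AE x in lebesgue. (\<lambda>m. ?g x * \<phi> m x) \<longlonglongrightarrow> ?g x * indicator (box a b) x"
      by (intro always_eventually allI tendsto_mult tendsto_const \<phi>(4))
    show "AE x in lebesgue. norm (?g x * \<phi> m x) \<le> norm (?g x)" for m
    proof (intro always_eventually allI)
      fix x
      show "norm (?g x * \<phi> m x) \<le> norm (?g x)"
        using mult_left_mono[OF \<phi>(2)[of m x] norm_ge_zero[of "?g x"]]
        by (simp only: abs_mult real_norm_def mult_1_right)
    qed
    show "(\<lambda>x. ?g x * indicator (box a b) x) \<in> borel_measurable lebesgue"
      using gbox_int by auto
  qed (use g_int g_meas in auto)
  moreover have "(LINT x|lebesgue. ?g x * \<phi> m x) = 0" for m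
  proof -
    have "(LINT x|lebesgue. ?g x * \<phi> m x) = (LINT x|lebesgue. indicator \<Omega> x *\<^sub>R (g x * \<phi> m x))"
      using \<phi>(3)[of _ m] ab box_subset_cbox[of a b]
      by (intro Bochner_Integration.integral_cong refl) (auto simp: indicator_def)
    also have "\<dots> = 0"
      using orth[OF test[of m]] \<Omega>_sets by (simp add: integral_restrict_space)
    finally show ?thesis .
  qed
  ultimately have "(LINT x|lebesgue. ?g x * indicator (box a b) x) = 0"
    by (simp add: LIMSEQ_const_iff)
  moreover have "(LINT x|lebesgue. ?g x * indicator (box a b) x) = (LINT x:box a b|lebesgue. g x)"
    unfolding set_lebesgue_integral_def using box_subset_cbox[of a b]
    by (intro Bochner_Integration.integral_cong refl) (auto simp: indicator_def)
  ultimately show ?thesis by simp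
qed

text \<open>On each closed box inside \<open>\<Omega>\<close>, the function cut off to the open box has vanishing integral over
  every box, since two boxes meet in a box. Countably many closed boxes exhaust \<open>\<Omega>\<close>.\<close>

lemma du_Bois_Reymond:
  fixes g :: "real ^ 'd \<Rightarrow> real"
  assumes \<Omega>: "open \<Omega>" and g: "locally_integrable_on \<Omega> g"
    and orth: "\<And>\<phi>. \<phi> \<in> C1_compact_support \<Omega> \<Longrightarrow> (LINT x|lebesgue_on \<Omega>. g x * \<phi> x) = 0"
  shows "AE x in lebesgue_on \<Omega>. g x = 0"
proof -
  have on_cbox: "AE x in lebesgue. x \<in> cbox c d \<longrightarrow> g x = 0" if cd: "cbox c d \<subseteq> \<Omega>" for c d
  proof -
    let ?g = "\<lambda>x. indicator (box c d) x *\<^sub>R g x"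
    have "integrable lebesgue (\<lambda>x. indicator (cbox c d) x *\<^sub>R g x)"
      using g compact_cbox cd by (rule locally_integrable_onD)
    from integrable_mult_indicator[OF _ this, of "box c d"]
    have "integrable lebesgue (\<lambda>x. indicator (box c d) x *\<^sub>R indicator (cbox c d) x *\<^sub>R g x)"
      by simp
    also have "(\<lambda>x. indicator (box c d) x *\<^sub>R indicator (cbox c d) x *\<^sub>R g x) = ?g"
      using box_subset_cbox[of c d] by (auto simp: fun_eq_iff indicator_def)
    finally have "AE x in lebesgue. ?g x = 0"
    proof (rule AE_zero_if_integral_boxes_zero)
      fix a b :: "real ^ 'd"
      obtain a' b' where ab': "box a b \<inter> box c d = box a' b'"
        using box_Int_box[of a b c d] by blast
      have "(LINT x:box a b|lebesgue. ?g x) = (LINT x:box a' b'|lebesgue. g x)"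
        unfolding set_lebesgue_integral_def ab'[symmetric]
        by (intro Bochner_Integration.integral_cong refl) (auto simp: indicator_def)
      also have "\<dots> = 0"
      proof (cases "box a' b' = {}")
        case False
        have "cbox a' b' = closure (box a' b')"
          using False by simp
        also have "\<dots> \<subseteq> cbox c d"
          using ab' box_subset_cbox[of c d] by (intro closure_minimal) auto
        finally show ?thesis
          using cd by (intro integral_box_zero_if_orthogonal_to_test_functions[OF \<Omega> g orth]) auto
      qed (simp add: set_lebesgue_integral_def)
      finally show "(LINT x:box a b|lebesgue. ?g x) = 0" .
    qed
    moreover have "AE x in lebesgue. x \<notin> cbox c d - box c d"
      using negligible_frontier_interval[of c d] by (intro AE_not_in) (simp add: negligible_iff_null_sets)
    ultimately show ?thesis
      by eventually_elim (auto simp: indicator_def)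
  qed
  obtain \<D> where \<D>: "countable \<D>" "\<D> \<subseteq> Pow \<Omega>" "\<And>X. X \<in> \<D> \<Longrightarrow> \<exists>a b. X = cbox a b" "\<Union>\<D> = \<Omega>"
    using open_countable_Union_open_cbox[OF \<Omega>] by metis
  have "AE x in lebesgue. \<forall>X\<in>\<D>. x \<in> X \<longrightarrow> g x = 0"
  proof (rule AE_ball_countable[THEN iffD2, OF \<D>(1)], rule ballI)
    fix X assume "X \<in> \<D>"
    then obtain c d where "X = cbox c d" "cbox c d \<subseteq> \<Omega>"
      using \<D>(2,3) by blast
    then show "AE x in lebesgue. x \<in> X \<longrightarrow> g x = 0"
      using on_cbox by simp
  qed
  then have "AE x in lebesgue. x \<in> \<Omega> \<longrightarrow> g x = 0"
    by eventually_elim (use \<D>(4) in blast)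
  then show ?thesis
    using \<Omega> by (subst AE_restrict_space_iff) auto
qed

section \<open>Almost everywhere linearity of the weak gradient\<close>

lemma locally_integrable_on_component:
  fixes u :: "real ^ 'd \<Rightarrow> 'b::euclidean_space ^ 'e"
  assumes "locally_integrable_on \<Omega> u"
  shows "locally_integrable_on \<Omega> (\<lambda>x. u x $ i)"
  unfolding locally_integrable_on_def
proof (intro allI impI)
  fix K assume K: "compact K \<and> K \<subseteq> \<Omega>"
  have "integrable (lebesgue_on K) u"
    by (rule assms[unfolded locally_integrable_on_def, rule_format, OF K])
  from integrable_bounded_linear[OF bounded_linear_vec_nth[of i] this]
  show "integrable (lebesgue_on K) (\<lambda>x. u x $ i)" .
qed

lemma locally_integrable_on_linear_combination:
  assumes "locally_integrable_on \<Omega> u" "locally_integrable_on \<Omega> v"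
  shows "locally_integrable_on \<Omega> (\<lambda>x. c *\<^sub>R u x + d *\<^sub>R v x)"
  unfolding locally_integrable_on_def
proof (intro allI impI)
  fix K assume K: "compact K \<and> K \<subseteq> \<Omega>"
  have "integrable (lebesgue_on K) u" "integrable (lebesgue_on K) v"
    by (rule assms[unfolded locally_integrable_on_def, rule_format, OF K])+
  then show "integrable (lebesgue_on K) (\<lambda>x. c *\<^sub>R u x + d *\<^sub>R v x)"
    by (intro Bochner_Integration.integrable_add integrable_scaleR_right)
qed

lemma has_weak_gradientD:
  assumes "has_weak_gradient \<Omega> v G"
  shows "locally_integrable_on \<Omega> v" "locally_integrable_on \<Omega> G"
    and "\<phi> \<in> C1_compact_support \<Omega> \<Longrightarrow> (LINT x|lebesgue_on \<Omega>. v x $ i * partial_deriv j \<phi> x) =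
        - (LINT x|lebesgue_on \<Omega>. G x $ i $ j * \<phi> x)"
proof -
  note def = assms[unfolded has_weak_gradient_def]
  show "locally_integrable_on \<Omega> v" "locally_integrable_on \<Omega> G"
    by (rule conjunct1[OF def], rule conjunct1[OF conjunct2[OF def]])
  show "(LINT x|lebesgue_on \<Omega>. v x $ i * partial_deriv j \<phi> x) = - (LINT x|lebesgue_on \<Omega>. G x $ i $ j * \<phi> x)"
    if "\<phi> \<in> C1_compact_support \<Omega>"
    by (rule spec[OF spec[OF bspec[OF conjunct2[OF conjunct2[OF def]] that]]])
qed

lemma has_weak_gradient_linear_combination:
  fixes u v :: "real ^ 'd \<Rightarrow> real ^ 'd"
  assumes \<Omega>: "open \<Omega>" and G: "has_weak_gradient \<Omega> u G" and G': "has_weak_gradient \<Omega> v G'"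
  shows "has_weak_gradient \<Omega> (\<lambda>x. c *\<^sub>R u x + d *\<^sub>R v x) (\<lambda>x. c *\<^sub>R G x + d *\<^sub>R G' x)"
  unfolding has_weak_gradient_def
proof (intro conjI ballI allI)
  have loc: "locally_integrable_on \<Omega> u" "locally_integrable_on \<Omega> v"
    "locally_integrable_on \<Omega> G" "locally_integrable_on \<Omega> G'"
    by (rule has_weak_gradientD(1,2)[OF G] has_weak_gradientD(1,2)[OF G'])+
  show "locally_integrable_on \<Omega> (\<lambda>x. c *\<^sub>R u x + d *\<^sub>R v x)"
    "locally_integrable_on \<Omega> (\<lambda>x. c *\<^sub>R G x + d *\<^sub>R G' x)"
    by (intro locally_integrable_on_linear_combination loc)+
  fix \<phi> :: "real ^ 'd \<Rightarrow> real" and i j assume \<phi>: "\<phi> \<in> C1_compact_support \<Omega>"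
  note int = integrable_mult_test_function[OF \<Omega> _ \<phi>]
  have "(LINT x|lebesgue_on \<Omega>. (c *\<^sub>R u x + d *\<^sub>R v x) $ i * partial_deriv j \<phi> x)
      = (LINT x|lebesgue_on \<Omega>. c * (u x $ i * partial_deriv j \<phi> x) + d * (v x $ i * partial_deriv j \<phi> x))"
    by (intro Bochner_Integration.integral_cong refl) (simp add: algebra_simps)
  also have "\<dots> = c * (LINT x|lebesgue_on \<Omega>. u x $ i * partial_deriv j \<phi> x)
      + d * (LINT x|lebesgue_on \<Omega>. v x $ i * partial_deriv j \<phi> x)"
    using int(2)[OF locally_integrable_on_component[OF loc(1)]]
      int(2)[OF locally_integrable_on_component[OF loc(2)]] by simp
  also have "\<dots> = - (c * (LINT x|lebesgue_on \<Omega>. G x $ i $ j * \<phi> x)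
      + d * (LINT x|lebesgue_on \<Omega>. G' x $ i $ j * \<phi> x))"
    by (simp add: has_weak_gradientD(3)[OF G \<phi>] has_weak_gradientD(3)[OF G' \<phi>])
  also have "c * (LINT x|lebesgue_on \<Omega>. G x $ i $ j * \<phi> x)
      + d * (LINT x|lebesgue_on \<Omega>. G' x $ i $ j * \<phi> x)
      = (LINT x|lebesgue_on \<Omega>. c * (G x $ i $ j * \<phi> x) + d * (G' x $ i $ j * \<phi> x))"
    using int(1)[OF locally_integrable_on_component[OF locally_integrable_on_component[OF loc(3)]]]
      int(1)[OF locally_integrable_on_component[OF locally_integrable_on_component[OF loc(4)]]] by simp
  also have "\<dots> = (LINT x|lebesgue_on \<Omega>. (c *\<^sub>R G x + d *\<^sub>R G' x) $ i $ j * \<phi> x)"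
    by (intro Bochner_Integration.integral_cong refl) (simp add: algebra_simps)
  finally show "(LINT x|lebesgue_on \<Omega>. (c *\<^sub>R u x + d *\<^sub>R v x) $ i * partial_deriv j \<phi> x)
      = - (LINT x|lebesgue_on \<Omega>. (c *\<^sub>R G x + d *\<^sub>R G' x) $ i $ j * \<phi> x)" .
qed

text \<open>The difference of two weak gradients of \<open>v\<close> is a weak gradient of zero, hence orthogonal to all
  test functions in each entry.\<close>

lemma has_weak_gradient_unique:
  assumes \<Omega>: "open \<Omega>" and G: "has_weak_gradient \<Omega> v G" and G': "has_weak_gradient \<Omega> v G'"
  shows "AE x in lebesgue_on \<Omega>. G x = G' x"
proof -
  have diff: "has_weak_gradient \<Omega> (\<lambda>x. 1 *\<^sub>R v x + (-1) *\<^sub>R v x) (\<lambda>x. 1 *\<^sub>R G x + (-1) *\<^sub>R G' x)"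
    using \<Omega> G G' by (rule has_weak_gradient_linear_combination)
  have "AE x in lebesgue_on \<Omega>. (1 *\<^sub>R G x + (-1) *\<^sub>R G' x) $ i $ j = 0" for i j
  proof (rule du_Bois_Reymond[OF \<Omega>])
    show "locally_integrable_on \<Omega> (\<lambda>x. (1 *\<^sub>R G x + (-1) *\<^sub>R G' x) $ i $ j)"
      using diff unfolding has_weak_gradient_def by (intro locally_integrable_on_component) auto
    show "(LINT x|lebesgue_on \<Omega>. (1 *\<^sub>R G x + (-1) *\<^sub>R G' x) $ i $ j * \<phi> x) = 0"
      if "\<phi> \<in> C1_compact_support \<Omega>" for \<phi>
      using diff that unfolding has_weak_gradient_def by simp
  qed
  then have "AE x in lebesgue_on \<Omega>. \<forall>i j. (1 *\<^sub>R G x + (-1) *\<^sub>R G' x) $ i $ j = 0"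
    by (simp add: eventually_all_finite)
  then show ?thesis
    by eventually_elim (simp add: vec_eq_iff)
qed

lemma has_weak_gradient_weak_grad:
  "\<exists>G. has_weak_gradient \<Omega> v G \<Longrightarrow> has_weak_gradient \<Omega> v (weak_grad \<Omega> v)"
  unfolding weak_grad_def by (rule someI_ex[where P = "has_weak_gradient \<Omega> v"])

text \<open>\<open>weak_grad\<close> selects an arbitrary weak gradient of each field separately, so its choices for
  \<open>u\<close>, \<open>v\<close> and their combination are related only through uniqueness up to null sets.\<close>

lemma weak_grad_linear_combination:
  assumes \<Omega>: "open \<Omega>" and u: "\<exists>G. has_weak_gradient \<Omega> u G" and v: "\<exists>G. has_weak_gradient \<Omega> v G"
  shows "AE x in lebesgue_on \<Omega>. weak_grad \<Omega> (\<lambda>x. c *\<^sub>R u x + d *\<^sub>R v x) x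
           = c *\<^sub>R weak_grad \<Omega> u x + d *\<^sub>R weak_grad \<Omega> v x"
proof -
  have "has_weak_gradient \<Omega> (\<lambda>x. c *\<^sub>R u x + d *\<^sub>R v x)
      (\<lambda>x. c *\<^sub>R weak_grad \<Omega> u x + d *\<^sub>R weak_grad \<Omega> v x)"
    using \<Omega> u v by (intro has_weak_gradient_linear_combination has_weak_gradient_weak_grad)
  then show ?thesis
    using has_weak_gradient_weak_grad by (intro has_weak_gradient_unique[OF \<Omega>]) blast+
qed

section \<open>Integrability of the terms in the energy balance\<close>

text \<open>On a set of finite measure, \<open>L\<^sup>3\<close> is contained in \<open>L\<^sup>2\<close> because \<open>r\<^sup>2 \<le> 1 + r\<^sup>3\<close> for \<open>r \<ge> 0\<close>.\<close>

lemma Lp_space_3_powers: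
  assumes \<Omega>: "\<Omega> \<in> lmeasurable" and u: "u \<in> Lp_space 3 \<Omega>"
  shows "u \<in> borel_measurable (lebesgue_on \<Omega>)"
    and "integrable (lebesgue_on \<Omega>) (\<lambda>x. norm (u x) ^ 3)"
    and "integrable (lebesgue_on \<Omega>) (\<lambda>x. (norm (u x))\<^sup>2)"
proof -
  show meas: "u \<in> borel_measurable (lebesgue_on \<Omega>)"
    using u by (simp add: Lp_space_def)
  have "norm (u x) powr 3 = norm (u x) ^ 3" for x
    by (cases "u x = 0") (simp_all add: powr_numeral)
  then show cube: "integrable (lebesgue_on \<Omega>) (\<lambda>x. norm (u x) ^ 3)"
    using u by (simp add: Lp_space_def)
  have "finite_measure (lebesgue_on \<Omega>)"
    using \<Omega> by (rule finite_measure_lebesgue_on)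
  then have "integrable (lebesgue_on \<Omega>) (\<lambda>x. 1 :: real)"
    by (rule finite_measure.integrable_const)
  then have "integrable (lebesgue_on \<Omega>) (\<lambda>x. 1 + norm (u x) ^ 3)"
    using cube by (rule Bochner_Integration.integrable_add)
  then show "integrable (lebesgue_on \<Omega>) (\<lambda>x. (norm (u x))\<^sup>2)"
  proof (rule Bochner_Integration.integrable_bound)
    show "(\<lambda>x. (norm (u x))\<^sup>2) \<in> borel_measurable (lebesgue_on \<Omega>)"
      using meas by measurable
    show "AE x in lebesgue_on \<Omega>. norm ((norm (u x))\<^sup>2) \<le> norm (1 + norm (u x) ^ 3)"
    proof (intro always_eventually allI)
      fix x
      have "r\<^sup>2 \<le> 1 + r ^ 3" if "r \<ge> 0" for r :: real
      proof (cases "r \<le> 1")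
        case True
        then have "r\<^sup>2 \<le> 1"
          using that by (simp add: power_le_one)
        then show ?thesis
          using zero_le_power[OF that, of 3] by linarith
      next
        case False
        then have "r\<^sup>2 \<le> r ^ 3"
          by (intro power_increasing) auto
        then show ?thesis by linarith
      qed
      from this[of "norm (u x)"] show "norm ((norm (u x))\<^sup>2) \<le> norm (1 + norm (u x) ^ 3)"
        by simp
    qed
  qed
qed

lemma integrable_inner_L2:
  fixes u v :: "'a \<Rightarrow> 'b::euclidean_space"
  assumes "u \<in> borel_measurable M" "v \<in> borel_measurable M"
    and "integrable M (\<lambda>x. (norm (u x))\<^sup>2)" "integrable M (\<lambda>x. (norm (v x))\<^sup>2)"
  shows "integrable M (\<lambda>x. u x \<bullet> v x)"
proof (rule Bochner_Integration.integrable_bound[OF Bochner_Integration.integrable_add[OF assms(3,4)]])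
  show "(\<lambda>x. u x \<bullet> v x) \<in> borel_measurable M"
    using assms(1,2) by measurable
  show "AE x in M. norm (u x \<bullet> v x) \<le> norm ((norm (u x))\<^sup>2 + (norm (v x))\<^sup>2)"
  proof (intro always_eventually allI)
    fix x
    have "\<bar>u x \<bullet> v x\<bar> \<le> norm (u x) * norm (v x)"
      by (rule Cauchy_Schwarz_ineq2)
    also have "\<dots> \<le> (norm (u x))\<^sup>2 + (norm (v x))\<^sup>2"
      using sum_squares_bound[of "norm (u x)" "norm (v x)"]
        mult_nonneg_nonneg[OF norm_ge_zero norm_ge_zero, of "u x" "v x"] by linarith
    finally show "norm (u x \<bullet> v x) \<le> norm ((norm (u x))\<^sup>2 + (norm (v x))\<^sup>2)"
      by simp
  qed
qed

text \<open>This is why velocity gradients are taken in \<open>L\<^sup>3\<close>: the Smagorinsky dissipation is cubic in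
  them. For \<open>r, s \<ge> 0\<close> the bound is \<open>r s\<^sup>2 \<le> (max r s)\<^sup>3 \<le> r\<^sup>3 + s\<^sup>3\<close>.\<close>

lemma integrable_mult_square_L3:
  fixes r s :: "'a \<Rightarrow> real"
  assumes "r \<in> borel_measurable M" "s \<in> borel_measurable M"
    and "\<And>x. r x \<ge> 0" "\<And>x. s x \<ge> 0"
    and "integrable M (\<lambda>x. r x ^ 3)" "integrable M (\<lambda>x. s x ^ 3)"
  shows "integrable M (\<lambda>x. r x * (s x)\<^sup>2)"
proof (rule Bochner_Integration.integrable_bound[OF Bochner_Integration.integrable_add[OF assms(5,6)]])
  show "(\<lambda>x. r x * (s x)\<^sup>2) \<in> borel_measurable M"
    using assms(1,2) by measurable
  have bound: "r x * (s x)\<^sup>2 \<le> r x ^ 3 + s x ^ 3" for x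
  proof (cases "r x \<le> s x")
    case True
    then have "r x * (s x)\<^sup>2 \<le> s x * (s x)\<^sup>2"
      by (intro mult_right_mono) auto
    then show ?thesis
      using zero_le_power[OF assms(3), of x 3] by (simp add: power2_eq_square power3_eq_cube)
  next
    case False
    then have "(s x)\<^sup>2 \<le> (r x)\<^sup>2"
      using assms(4)[of x] by (intro power_mono) auto
    then have "r x * (s x)\<^sup>2 \<le> r x * (r x)\<^sup>2"
      using assms(3)[of x] by (rule mult_left_mono)
    then show ?thesis
      using zero_le_power[OF assms(4), of x 3] by (simp add: power2_eq_square power3_eq_cube)
  qed
  show "AE x in M. norm (r x * (s x)\<^sup>2) \<le> norm (r x ^ 3 + s x ^ 3)"
    using bound assms(3,4) by (intro always_eventually allI) (simp add: abs_mult)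
qed

section \<open>The energy balance of one step and its sum\<close>

lemma L2_norm_squared: "(L2_norm \<Omega> u)\<^sup>2 = L2_inner \<Omega> u u"
  unfolding L2_norm_def by (simp add: L2_inner_def)

lemma L2_inner_commute: "L2_inner \<Omega> u v = L2_inner \<Omega> v u"
  unfolding L2_inner_def by (simp add: inner_commute)

text \<open>Skew-symmetry of the convective form: it moves kinetic energy around without producing any.\<close>

lemma b_star_same: "b_star \<Omega> u v v = 0"
  unfolding b_star_def by simp

text \<open>The reason for the half-step average: \<open>(u' - u) \<bullet> (u + u') = |u'|\<^sup>2 - |u|\<^sup>2\<close>, so that a difference
  quotient tested with the mean is exactly a difference of energies. The mean is required only
  almost everywhere because that is all that holds for gradients.\<close>

lemma L2_inner_difference_quotient_mean:
  fixes u u' z :: "real ^ 'd \<Rightarrow> 'b::euclidean_space"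
  assumes u: "u \<in> borel_measurable (lebesgue_on \<Omega>)" "integrable (lebesgue_on \<Omega>) (\<lambda>x. (norm (u x))\<^sup>2)"
    and u': "u' \<in> borel_measurable (lebesgue_on \<Omega>)" "integrable (lebesgue_on \<Omega>) (\<lambda>x. (norm (u' x))\<^sup>2)"
    and z: "z \<in> borel_measurable (lebesgue_on \<Omega>)"
    and mean: "AE x in lebesgue_on \<Omega>. z x = (1/2) *\<^sub>R (u x + u' x)"
    and k: "k \<noteq> 0"
  shows "k * L2_inner \<Omega> (\<lambda>x. (1/k) *\<^sub>R (u' x - u x)) z
    = 1/2 * (L2_norm \<Omega> u')\<^sup>2 - 1/2 * (L2_norm \<Omega> u)\<^sup>2"
proof -
  have "L2_inner \<Omega> (\<lambda>x. (1/k) *\<^sub>R (u' x - u x)) z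
      = (LINT x|lebesgue_on \<Omega>. (1 / (2*k)) * (u' x \<bullet> u' x - u x \<bullet> u x))"
    unfolding L2_inner_def
  proof (rule integral_cong_AE)
    show "AE x in lebesgue_on \<Omega>. (1/k) *\<^sub>R (u' x - u x) \<bullet> z x
        = (1 / (2*k)) * (u' x \<bullet> u' x - u x \<bullet> u x)"
      using mean
    proof eventually_elim
      case (elim x)
      show ?case
        unfolding elim by (simp add: inner_diff_left inner_diff_right inner_add_right inner_commute)
    qed
  qed (use u u' z in measurable)
  also have "\<dots> = (1 / (2*k)) * (L2_inner \<Omega> u' u' - L2_inner \<Omega> u u)"
    unfolding L2_inner_def
    using integrable_inner_L2[OF u(1) u(1) u(2) u(2)] integrable_inner_L2[OF u'(1) u'(1) u'(2) u'(2)]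
    by simp
  finally show ?thesis
    using k by (simp add: L2_norm_squared field_simps)
qed

lemma finite_dim_subspace_linear_combination:
  assumes V: "finite_dim_subspace \<Omega> V" and u: "u \<in> V" and v: "v \<in> V"
  shows "(\<lambda>x. c *\<^sub>R u x + d *\<^sub>R v x) \<in> V"
proof -
  have add: "\<forall>u \<in> V. \<forall>v \<in> V. (\<lambda>x. u x + v x) \<in> V"
    and scale: "\<forall>c. \<forall>u \<in> V. (\<lambda>x. c *\<^sub>R u x) \<in> V"
    using V by (simp_all add: finite_dim_subspace_def)
  from bspec[OF bspec[OF add bspec[OF spec[OF scale] u]] bspec[OF spec[OF scale] v]]
  show ?thesis .
qed

lemma half_step_eq_linear_combination:
  "half_step w n = (\<lambda>x. (1/2) *\<^sub>R w n x + (1/2) *\<^sub>R w (n + 1) x)"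
  by (simp add: half_step_def[abs_def] scaleR_add_right)

lemma extrapolated_eq_linear_combination:
  "extrapolated w n = (\<lambda>x. (3/2) *\<^sub>R w n x + (-1/2) *\<^sub>R w (n - 1) x)"
  by (simp add: extrapolated_def[abs_def] scaleR_diff_right)

lemma weak_grad_half_step:
  assumes \<Omega>: "open \<Omega>"
    and w: "\<exists>G. has_weak_gradient \<Omega> (w n) G" "\<exists>G. has_weak_gradient \<Omega> (w (n + 1)) G"
  shows "AE x in lebesgue_on \<Omega>. weak_grad \<Omega> (half_step w n) x
           = (1/2) *\<^sub>R (weak_grad \<Omega> (w n) x + weak_grad \<Omega> (w (n + 1)) x)"
  using weak_grad_linear_combination[OF \<Omega> w, of "1/2" "1/2"]
  unfolding half_step_eq_linear_combination by (simp add: scaleR_add_right)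

text \<open>Splitting the integral needs both parts finite: the viscous one is so in \<open>L\<^sup>2\<close>, the eddy-viscous
  one only by the cubic bound in \<open>L\<^sup>3\<close>.\<close>

lemma dissipation_integral_split:
  assumes \<Omega>: "\<Omega> \<in> lmeasurable"
    and A: "A \<in> Lp_space 3 \<Omega>" and B: "B \<in> Lp_space 3 \<Omega>"
  shows "(LINT x|lebesgue_on \<Omega>. (\<nu> + c * norm (A x)) * (norm (B x))\<^sup>2)
    = \<nu> * L2_inner \<Omega> B B + c * L2_inner \<Omega> (\<lambda>x. norm (A x) *\<^sub>R B x) B"
proof -
  note A = Lp_space_3_powers[OF \<Omega> A] and B = Lp_space_3_powers[OF \<Omega> B]
  have "integrable (lebesgue_on \<Omega>) (\<lambda>x. norm (A x) * (norm (B x))\<^sup>2)"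
    using A B by (intro integrable_mult_square_L3) (auto intro: borel_measurable_norm)
  then have "(LINT x|lebesgue_on \<Omega>. \<nu> * (norm (B x))\<^sup>2 + c * (norm (A x) * (norm (B x))\<^sup>2))
      = \<nu> * (LINT x|lebesgue_on \<Omega>. (norm (B x))\<^sup>2)
        + c * (LINT x|lebesgue_on \<Omega>. norm (A x) * (norm (B x))\<^sup>2)"
    using B(3) by simp
  then show ?thesis
    unfolding L2_inner_def by (simp add: power2_norm_eq_inner algebra_simps)
qed

text \<open>The momentum equation is tested with the half-step velocity itself, which lies in the discrete
  space. The half-step pressure lies in its discrete space as well, so the discrete incompressibility
  constraint cancels the pressure term, and skew-symmetry cancels convection. The two difference
  quotients become the increments of the velocity and gradient parts of the energy.\<close>

lemma crank_nicolson_step_energy: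
  assumes \<Omega>: "open \<Omega>" "bounded \<Omega>"
    and V: "V \<subseteq> velocity_space \<Omega>" "finite_dim_subspace \<Omega> V"
    and P: "finite_dim_subspace \<Omega> P"
    and k: "k > 0"
    and w: "w (n - 1) \<in> V" "w n \<in> V" "w (n + 1) \<in> V"
    and p: "p n \<in> P" "p (n + 1) \<in> P"
    and step: "crank_nicolson_step \<Omega> V P \<nu> C \<delta> \<mu> \<gamma> k f w p n"
  defines "energy \<equiv> \<lambda>m. 1/2 * (L2_norm \<Omega> (w m))\<^sup>2
      + 1/2 * (C^4 * \<delta>^2 / \<mu>^2) * (L2_norm \<Omega> (weak_grad \<Omega> (w m)))\<^sup>2"
  shows "energy (n + 1) - energy n
    + k * ((LINT x|lebesgue_on \<Omega>.
              (\<nu> + (C * \<delta>)^2 * norm (weak_grad \<Omega> (extrapolated w n) x)) *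
              (norm (weak_grad \<Omega> (half_step w n) x))^2)
           + \<gamma> * (L2_norm \<Omega> (weak_div \<Omega> (half_step w n)))\<^sup>2)
    = k * L2_inner \<Omega> (half_step (at_time_level k f) n) (half_step w n)"
proof -
  let ?z = "half_step w n" and ?e = "extrapolated w n"
  let ?c = "C^4 * \<delta>^2 / \<mu>^2"
  have \<Omega>_lmeas: "\<Omega> \<in> lmeasurable"
    using \<Omega> by (simp add: lmeasurable_open)
  have z: "?z \<in> V"
    unfolding half_step_eq_linear_combination
    using V(2) w(2,3) by (rule finite_dim_subspace_linear_combination)
  have e: "?e \<in> V"
    unfolding extrapolated_eq_linear_combination
    using V(2) w(2,1) by (rule finite_dim_subspace_linear_combination)
  have vel: "u \<in> Lp_space 3 \<Omega>" "weak_grad \<Omega> u \<in> Lp_space 3 \<Omega>" "\<exists>G. has_weak_gradient \<Omega> u G"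
    if "u \<in> V" for u
    using that V(1) unfolding velocity_space_def by blast+
  note L3 = Lp_space_3_powers[OF \<Omega>_lmeas vel(1)] and grad_L3 = Lp_space_3_powers[OF \<Omega>_lmeas vel(2)]
  have kinetic: "k * L2_inner \<Omega> (\<lambda>x. (1/k) *\<^sub>R (w (n + 1) x - w n x)) ?z
      = 1/2 * (L2_norm \<Omega> (w (n + 1)))\<^sup>2 - 1/2 * (L2_norm \<Omega> (w n))\<^sup>2"
    using L3 w z k by (intro L2_inner_difference_quotient_mean) (auto simp: half_step_def)
  have gradient: "k * L2_inner \<Omega> (\<lambda>x. (1/k) *\<^sub>R (weak_grad \<Omega> (w (n + 1)) x - weak_grad \<Omega> (w n) x))
        (weak_grad \<Omega> ?z)
      = 1/2 * (L2_norm \<Omega> (weak_grad \<Omega> (w (n + 1))))\<^sup>2 - 1/2 * (L2_norm \<Omega> (weak_grad \<Omega> (w n)))\<^sup>2"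
    using k by (intro L2_inner_difference_quotient_mean grad_L3 weak_grad_half_step \<Omega> vel w z) auto
  have "half_step p n \<in> P"
    unfolding half_step_eq_linear_combination
    using P p by (rule finite_dim_subspace_linear_combination)
  then have pressure: "L2_inner \<Omega> (half_step p n) (weak_div \<Omega> ?z) = 0"
    using step unfolding crank_nicolson_step_def by (subst L2_inner_commute) blast
  let ?D = "L2_inner \<Omega> (\<lambda>x. (1/k) *\<^sub>R (w (n + 1) x - w n x)) ?z"
  let ?DG = "L2_inner \<Omega> (\<lambda>x. (1/k) *\<^sub>R (weak_grad \<Omega> (w (n + 1)) x - weak_grad \<Omega> (w n) x))
        (weak_grad \<Omega> ?z)"
  let ?diss = "LINT x|lebesgue_on \<Omega>. (\<nu> + (C * \<delta>)^2 * norm (weak_grad \<Omega> ?e x)) *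
              (norm (weak_grad \<Omega> ?z x))^2"
  let ?F = "L2_inner \<Omega> (half_step (at_time_level k f) n) ?z"
  have "?D + ?c * ?DG + b_star \<Omega> ?e ?z ?z + \<nu> * L2_inner \<Omega> (weak_grad \<Omega> ?z) (weak_grad \<Omega> ?z)
      + (C * \<delta>)^2 * L2_inner \<Omega> (\<lambda>x. norm (weak_grad \<Omega> ?e x) *\<^sub>R weak_grad \<Omega> ?z x) (weak_grad \<Omega> ?z)
      + \<gamma> * L2_inner \<Omega> (weak_div \<Omega> ?z) (weak_div \<Omega> ?z)
      - L2_inner \<Omega> (half_step p n) (weak_div \<Omega> ?z) = ?F"
    using step z unfolding crank_nicolson_step_def by blast
  then have "?D + ?c * ?DG + ?diss + \<gamma> * (L2_norm \<Omega> (weak_div \<Omega> ?z))\<^sup>2 = ?F"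
    unfolding b_star_same pressure L2_norm_squared
      dissipation_integral_split[OF \<Omega>_lmeas vel(2)[OF e] vel(2)[OF z]] by linarith
  then have "k * ?D + ?c * (k * ?DG) + k * (?diss + \<gamma> * (L2_norm \<Omega> (weak_div \<Omega> ?z))\<^sup>2) = k * ?F"
    by (metis (no_types, lifting) add.assoc distrib_left mult.left_commute)
  then show ?thesis
    unfolding kinetic gradient energy_def by (simp add: algebra_simps)
qed

lemma sum_int_telescope:
  fixes E :: "int \<Rightarrow> 'a::ab_group_add"
  shows "(\<Sum>n = 0..int N - 1. E (n + 1) - E n) = E (int N) - E 0"
proof (induction N)
  case (Suc N)
  have "{0..int (Suc N) - 1} = insert (int N) {0..int N - 1}"
    by auto
  then show ?case
    using Suc by (simp add: add.commute)
qed simp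

theorem theorem5p8:
  fixes \<Omega> :: "(real ^ 'd) set"
    and \<nu> C\<^sub>s \<delta> \<mu> \<gamma> k \<beta>\<^sub>0 h :: real
    and H :: "real set" and \<beta> :: "real \<Rightarrow> real"
    and X\<^sub>h :: "real \<Rightarrow> (real ^ 'd \<Rightarrow> real ^ 'd) set"
    and Q\<^sub>h :: "real \<Rightarrow> (real ^ 'd \<Rightarrow> real) set"
    and f :: "real ^ 'd \<Rightarrow> real \<Rightarrow> real ^ 'd"
    and w :: "int \<Rightarrow> real ^ 'd \<Rightarrow> real ^ 'd"
    and p :: "int \<Rightarrow> real ^ 'd \<Rightarrow> real"
    and N :: nat
  assumes dim: "CARD('d) = 2 \<or> CARD('d) = 3"
    and domain: "regular_bounded_domain \<Omega>"
    and constants: "\<nu> > 0" "C\<^sub>s > 0" "\<delta> > 0" "\<mu> > 0"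
    and time_step: "k > 0"
    and mesh: "H \<subseteq> {0<..}" "h \<in> H"
    and fe_spaces:
      "\<And>h. h \<in> H \<Longrightarrow> X\<^sub>h h \<subseteq> velocity_space \<Omega> \<and> finite_dim_subspace \<Omega> (X\<^sub>h h)"
      "\<And>h. h \<in> H \<Longrightarrow> Q\<^sub>h h \<subseteq> pressure_space \<Omega> \<and> finite_dim_subspace \<Omega> (Q\<^sub>h h)"
    and inf_sup: "\<beta>\<^sub>0 > 0"
      "\<And>h. h \<in> H \<Longrightarrow> \<beta>\<^sub>0 \<le> \<beta> h \<and> inf_sup_condition \<Omega> (X\<^sub>h h) (Q\<^sub>h h) (\<beta> h)"
    and N: "N \<ge> 1"
    and velocities: "\<And>n. -1 \<le> n \<Longrightarrow> n \<le> int N \<Longrightarrow> w n \<in> X\<^sub>h h"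
    and pressures: "\<And>n. 0 \<le> n \<Longrightarrow> n \<le> int N \<Longrightarrow> p n \<in> Q\<^sub>h h"
    and scheme: "\<And>n. 0 \<le> n \<Longrightarrow> n < int N \<Longrightarrow>
      crank_nicolson_step \<Omega> (X\<^sub>h h) (Q\<^sub>h h) \<nu> C\<^sub>s \<delta> \<mu> \<gamma> k f w p n"
  shows
    "(1/2 * (L2_norm \<Omega> (w (int N)))^2
        + 1/2 * (C\<^sub>s^4 * \<delta>^2 / \<mu>^2) * (L2_norm \<Omega> (weak_grad \<Omega> (w (int N))))^2)
     + k * (\<Sum>n = 0..int N - 1.
         (LINT x|lebesgue_on \<Omega>.
            (\<nu> + (C\<^sub>s * \<delta>)^2 * norm (weak_grad \<Omega> (extrapolated w n) x)) *
            (norm (weak_grad \<Omega> (half_step w n) x))^2)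
         + \<gamma> * (L2_norm \<Omega> (weak_div \<Omega> (half_step w n)))^2)
     = (1/2 * (L2_norm \<Omega> (w 0))^2
        + 1/2 * (C\<^sub>s^4 * \<delta>^2 / \<mu>^2) * (L2_norm \<Omega> (weak_grad \<Omega> (w 0)))^2)
     + k * (\<Sum>n = 0..int N - 1. L2_inner \<Omega> (half_step (at_time_level k f) n) (half_step w n))"
proof -
  let ?energy = "\<lambda>m. 1/2 * (L2_norm \<Omega> (w m))\<^sup>2
      + 1/2 * (C\<^sub>s^4 * \<delta>^2 / \<mu>^2) * (L2_norm \<Omega> (weak_grad \<Omega> (w m)))\<^sup>2"
  let ?diss = "\<lambda>n. (LINT x|lebesgue_on \<Omega>.
            (\<nu> + (C\<^sub>s * \<delta>)^2 * norm (weak_grad \<Omega> (extrapolated w n) x)) *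
            (norm (weak_grad \<Omega> (half_step w n) x))^2)
         + \<gamma> * (L2_norm \<Omega> (weak_div \<Omega> (half_step w n)))^2"
  let ?work = "\<lambda>n. L2_inner \<Omega> (half_step (at_time_level k f) n) (half_step w n)"
  have \<Omega>: "open \<Omega>" "bounded \<Omega>"
    using domain by (auto simp: regular_bounded_domain_def)
  have "?energy (n + 1) - ?energy n + k * ?diss n = k * ?work n" if "n \<in> {0..int N - 1}" for n
    using that \<Omega> fe_spaces[OF mesh(2)] time_step velocities pressures scheme[of n]
    by (intro crank_nicolson_step_energy[where V = "X\<^sub>h h" and P = "Q\<^sub>h h" and p = p]) auto
  then have "(\<Sum>n = 0..int N - 1. (?energy (n + 1) - ?energy n) + k * ?diss n)
      = (\<Sum>n = 0..int N - 1. k * ?work n)"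
    by (intro sum.cong) auto
  then have "?energy (int N) - ?energy 0 + k * (\<Sum>n = 0..int N - 1. ?diss n)
      = k * (\<Sum>n = 0..int N - 1. ?work n)"
    by (simp only: sum_int_telescope[of ?energy N] sum_distrib_left
        sum.distrib[of "\<lambda>n. ?energy (n + 1) - ?energy n" "\<lambda>n. k * ?diss n"])
  then show ?thesis by linarith
qed

end
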